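(* Let $m\ge 1$ be a fixed integer. Then $$\{a^*_{mn}(j):n\ge 1,\ j\ge 0\}=\{c^*_{mn}(j):n\ge 1,\ j\ge 0\}=\mathbb Z.$$
   Context: A divisor $d$ of $n$ is a unitary divisor, written $d\,\|\,n$, if $\gcd(d,n/d)=1$. Let $\omega(n)$ be the number of distinct prime factors of $n$ and $\mu^*(n)=(-1)^{\omega(n)}$. The unitary cyclotomic polynomial is $\Phi^*_n(x)=\prod_{d\,\|\,n}(x^{d}-1)^{\mu^*(n/d)}$ (a monic polynomial with integer coefficients; equivalently $x^n-1=\prod_{d\,\|\,n}\Phi^*_d(x)$ for all $n$), and the inverse unitary cyclotomic polynomial is $\Psi^*_n(x)=(x^n-1)/\Phi^*_n(x)$, also a polynomial with integer coefficients. Their coefficients are defined for all $j\ge0$ by $\Phi^*_n(x)=\sum_{j\ge0}a^*_n(j)x^j$ and $\Psi^*_n(x)=\sum_{j\ge0}c^*_n(j)x^j$ (so they are $0$ beyond the degree). *)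

theory Defs
  imports "HOL-Computational_Algebra.Computational_Algebra"
begin

definition unitary_divisors :: "nat \<Rightarrow> nat set" where
  "unitary_divisors n = {d. d dvd n \<and> coprime d (n div d)}"

definition num_prime_factors :: "nat \<Rightarrow> nat" where
  "num_prime_factors n = card (prime_factors n)"

definition mu_unitary :: "nat \<Rightarrow> int" where
  "mu_unitary n = (-1) ^ num_prime_factors n"

definition x_pow_minus_one :: "nat \<Rightarrow> int poly" where
  "x_pow_minus_one n = monom 1 n - 1"

(* Some of the exponents are -1, so the defining product is formed in the field of
   fractions of the integer polynomials.  For n > 0 it lies in the image of the
   injective map to_fract, and the polynomial is its unique preimage. *)
definition unitary_cyclotomic_fract :: "nat \<Rightarrow> int poly fract" where
  "unitary_cyclotomic_fract n =
     (\<Prod>d\<in>unitary_divisors n. to_fract (x_pow_minus_one d) powi mu_unitary (n div d))"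

definition unitary_cyclotomic :: "nat \<Rightarrow> int poly" where
  "unitary_cyclotomic n = (THE p. to_fract p = unitary_cyclotomic_fract n)"

(* For n > 0 this division is exact. *)
definition inverse_unitary_cyclotomic :: "nat \<Rightarrow> int poly" where
  "inverse_unitary_cyclotomic n = x_pow_minus_one n div unitary_cyclotomic n"

end

theory Submission
  imports Defs "HOL-Analysis.Kronecker_Approximation_Theorem"
    "HOL-Number_Theory.Prime_Powers" "HOL-Number_Theory.Cong"
begin

text \<open>
  Write \<open>P\<^sub>n\<close> for the unitary cyclotomic polynomial and \<open>\<epsilon> = \<mu>\<^sup>*(M)\<close>. For a prime power \<open>q\<close>
  coprime to \<open>n\<close> the unitary divisors of \<open>n q\<close> are those of \<open>n\<close> and their multiples by \<open>q\<close>, so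
  \<open>P\<^bsub>nq\<^esub>(x) P\<^sub>n(x) = P\<^sub>n(x\<^sup>q) = 1 - \<mu>\<^sup>*(n) x\<^sup>q + O(x\<^bsup>2q\<^esup>)\<close> for \<open>n > 1\<close>.
  Let \<open>M > 1\<close> be a multiple of \<open>m\<close> and let \<open>Q\<close> be a set of pairwise coprime prime powers congruent
  to 1 modulo \<open>M\<close> with \<open>max Q < 2 min Q = l\<close>. Adjoining the elements of \<open>Q\<close> to \<open>M\<close> one after the other
  shows that modulo \<open>x\<^sup>l\<close> the polynomial at \<open>M \<Prod>Q\<close>, or its inverse power series if \<open>card Q\<close> is even,
  is \<open>(1 / P\<^sub>M) (1 - \<epsilon> (\<Sum>q\<in>Q. x\<^sup>q))\<close>. The coefficients of \<open>1 / P\<^sub>M = 1 + \<epsilon> x + \<dots>\<close> are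
  \<open>M\<close>-periodic, so the coefficient at the \<open>s\<close>-th element of \<open>Q\<close> is \<open>\<epsilon> (1 - s)\<close>. Both signs
  \<open>\<epsilon>\<close> occur among the multiples of \<open>m\<close>. Sets \<open>Q\<close> of any size are found among the powers of
  fixed primes by simultaneous Diophantine approximation of their logarithms.
\<close>

subsection \<open>Divisibility by and of \<open>x\<^sup>n - 1\<close>\<close>

lemma x_pow_minus_one_dvd_mult: "x_pow_minus_one a dvd x_pow_minus_one (a * b)"
proof -
  have "monom (1::int) (a * b) = monom 1 a ^ b"
    by (simp add: monom_power)
  then show ?thesis
    unfolding x_pow_minus_one_def by (metis power_diff_1_eq dvd_triv_left)
qed

lemma x_pow_minus_one_dvd: "a dvd b \<Longrightarrow> x_pow_minus_one a dvd x_pow_minus_one b"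
  using x_pow_minus_one_dvd_mult by (metis dvdE)

lemma x_pow_minus_one_neq_0: "n > 0 \<Longrightarrow> x_pow_minus_one n \<noteq> 0"
proof
  assume "n > 0" "x_pow_minus_one n = 0"
  then have "coeff (x_pow_minus_one n) n = 0" by simp
  with \<open>n > 0\<close> show False by (simp add: x_pow_minus_one_def)
qed

text \<open>Bezout in the exponents: \<open>aux\<close> subtracts a multiple of the polynomial at
  \<open>b * y\<close> from the one at \<open>a * x\<close> and leaves the one at \<open>d\<close>.
  Bezout over the naturals does not fix which side is larger, so \<open>aux\<close> is used in both
  orders.\<close>

lemma dvd_x_pow_minus_one_gcd:
  assumes "f dvd x_pow_minus_one a" "f dvd x_pow_minus_one b"
  shows "f dvd x_pow_minus_one (gcd a b)"
proof -
  have aux: "f dvd x_pow_minus_one d"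
    if "f dvd x_pow_minus_one a" "f dvd x_pow_minus_one b" "a * x = b * y + d" for a b x y d
  proof -
    have "f dvd x_pow_minus_one (b * y + d)" "f dvd x_pow_minus_one (b * y)"
      using that(1,2) unfolding that(3)[symmetric] by (auto intro: dvd_trans x_pow_minus_one_dvd_mult)
    moreover have "x_pow_minus_one d
        = x_pow_minus_one (b * y + d) - monom 1 d * x_pow_minus_one (b * y)"
      by (simp add: x_pow_minus_one_def right_diff_distrib mult_monom add.commute)
    ultimately show ?thesis by (metis dvd_diff dvd_mult)
  qed
  obtain d x y where d: "d dvd a" "d dvd b" and "a * x = b * y + d \<or> b * x = a * y + d"
    using bezout_add_nat by metis
  then have "f dvd x_pow_minus_one d"
    using aux[OF assms] aux[OF assms(2,1)] by blast
  with d show ?thesis by (metis x_pow_minus_one_dvd gcd_greatest dvd_trans)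
qed

text \<open>\<open>f\<close> divides x^n - 1 and its derivative, hence the constant
  \<open>n\<close>. Being constant, \<open>f\<close> then divides the constant term -1, which makes
  it a unit over the integers and not only over the rationals.\<close>

lemma square_dvd_x_pow_minus_one_imp_unit:
  assumes "f * f dvd x_pow_minus_one n" "n > 0"
  shows "is_unit f"
proof -
  obtain g where g: "x_pow_minus_one n = f * f * g" using assms by (elim dvdE)
  have "pderiv (x_pow_minus_one n) = monom (int n) (n - 1)"
    by (simp add: x_pow_minus_one_def pderiv_diff pderiv_monom)
  moreover have "f dvd pderiv (x_pow_minus_one n)"
    unfolding g by (simp add: pderiv_mult)
  moreover have "f dvd x_pow_minus_one n" unfolding g by simp
  ultimately have "f dvd monom 1 1 * monom (int n) (n - 1) - [:int n:] * x_pow_minus_one n"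
    by (metis dvd_diff dvd_mult)
  moreover have "monom 1 1 * monom (int n) (n - 1) - [:int n:] * x_pow_minus_one n = [:int n:]"
    using assms(2) by (simp add: x_pow_minus_one_def mult_monom algebra_simps smult_monom)
  ultimately have "f dvd [:int n:]" by metis
  then have "degree f = 0" using assms(2) by (metis dvd_imp_degree_le degree_pCons_0 le_zero_eq
    pCons_eq_0_iff of_nat_eq_0_iff less_numeral_extra(3))
  then obtain c where c: "f = [:c:]" by (metis degree_eq_zeroE)
  have "c dvd coeff (x_pow_minus_one n) 0" unfolding g c by simp
  then have "c dvd 1" using assms(2) by (simp add: x_pow_minus_one_def)
  then show ?thesis by (simp add: c is_unit_const_poly_iff)
qed

section \<open>Substituting powers of x in factorizations of x^N - 1\<close>

lemma pcompose_monom_monom: "pcompose (monom 1 d) (monom 1 q) = (monom 1 (d * q) :: 'a::comm_semiring_1 poly)"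
proof (induction d)
  case (Suc d)
  then show ?case by (simp add: monom_Suc[of _ d] pcompose_pCons mult_monom)
qed (simp add: monom_0)

lemma pcompose_x_pow_minus_one:
  "pcompose (x_pow_minus_one d) (monom 1 q) = x_pow_minus_one (d * q)"
  by (simp add: x_pow_minus_one_def pcompose_diff pcompose_monom_monom pcompose_1)

lemma pcompose_dvd: "p dvd r \<Longrightarrow> pcompose p s dvd pcompose r s"
  by (auto simp: pcompose_mult elim!: dvdE)

lemma pcompose_monom_comm:
  fixes p :: "'a::comm_ring_1 poly"
  shows "pcompose (pcompose p (monom 1 a)) (monom 1 b) = pcompose (pcompose p (monom 1 b)) (monom 1 a)"
  by (simp add: pcompose_assoc[symmetric] pcompose_monom_monom mult.commute)

text \<open>The condition on \<open>k\<close> is what makes divisibility, and hence the factorization, pass from \<open>n\<close> to \<open>n q\<close>.\<close>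
definition split_x_pow :: "nat \<Rightarrow> int poly \<Rightarrow> int poly \<Rightarrow> bool" where
  "split_x_pow N p r \<longleftrightarrow> p * r = x_pow_minus_one N \<and>
     (\<forall>k>0. coprime k N \<longrightarrow> p dvd pcompose p (monom 1 k) \<and> r dvd pcompose r (monom 1 k))"

text \<open>The new factor is p' = p(x^q) / p. With p(x^k) = p h, both p(x^q) = p p' and h divide
  p(x^(q k)). They are coprime, so p p' h divides p(x^(q k)) = p h p'(x^k), and cancelling p h gives
  the divisibility for p'.\<close>

lemma split_x_pow_mult:
  assumes N: "N > 0" and q: "q > 0" "coprime q N" and s: "split_x_pow N p r"
  obtains p' where "p * p' = pcompose p (monom 1 q)"
    "split_x_pow (N * q) p' (pcompose r (monom 1 q) * p)"
proof -
  have pr: "p * r = x_pow_minus_one N" using s by (simp add: split_x_pow_def)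
  have p0: "p \<noteq> 0" using pr N x_pow_minus_one_neq_0 by fastforce
  have pd: "p dvd pcompose p (monom 1 k)" and rd: "r dvd pcompose r (monom 1 k)"
    if "k > 0" "coprime k N" for k
    using s that by (auto simp: split_x_pow_def)
  have prk: "pcompose p (monom 1 k) * pcompose r (monom 1 k) = x_pow_minus_one (N * k)" for k
    using pr pcompose_mult pcompose_x_pow_minus_one by metis
  obtain p' where p': "pcompose p (monom 1 q) = p * p'" using pd[OF q] by (elim dvdE)
  have "p' dvd pcompose p' (monom 1 k)" if k: "k > 0" "coprime k (N * q)" for k
  proof -
    have kN: "coprime k N" "coprime k q" using k by auto
    obtain h where h: "pcompose p (monom 1 k) = p * h" using pd[OF k(1) kN(1)] by (elim dvdE)
    let ?p = "\<lambda>k. pcompose p (monom 1 k)" and ?r = "\<lambda>k. pcompose r (monom 1 k)"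
    \<comment> \<open>A common prime factor \<open>g\<close> would divide \<open>x\<^sup>N - 1 = p r\<close> and hence occur twice in some \<open>x\<^sup>n - 1\<close>.\<close>
    have "coprime (?p q) h"
    proof (rule ccontr)
      assume "\<not> coprime (?p q) h"
      then obtain f where f: "f dvd ?p q" "f dvd h" "\<not> is_unit f" by (rule not_coprimeE)
      have f0: "f \<noteq> 0" using f(1) p0 prk[of q] x_pow_minus_one_neq_0[of "N * q"] N q(1) by auto
      obtain g where g: "prime_elem g" "g dvd f" using f f0
        by (metis prime_divisor_exists prime_def)
      have gq: "g dvd ?p q" and gh: "g dvd h" using f g by (auto intro: dvd_trans)
      have gk: "g dvd ?p k" using gh h by simp
      have "g dvd x_pow_minus_one (gcd (N * q) (N * k))"
        using gq gk by (intro dvd_x_pow_minus_one_gcd) (simp_all add: prk[symmetric])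
      moreover have "gcd (N * q) (N * k) = N" using kN by (simp add: gcd_mult_distrib_nat[symmetric] coprime_iff_gcd_eq_1 gcd.commute)
      ultimately have "g dvd p * r" using pr by simp
      \<comment> \<open>Either \<open>g\<close> divides both factors of p(x^k) = p h, or it divides
        both p(x^q) and r(x^q), the latter because r divides r(x^q).\<close>
      then consider "g dvd p" | "g dvd r" using g(1) by (metis prime_elem_dvd_mult_iff)
      then have "\<exists>n>0. g * g dvd x_pow_minus_one n"
      proof cases
        case 1
        then have "g * g dvd ?p k" using gh h by (simp add: mult_dvd_mono)
        then show ?thesis using prk[of k] N k(1) by (intro exI[of _ "N * k"]) (simp add: prk[symmetric])
      next
        case 2
        then have "g dvd ?r q" using rd[OF q] dvd_trans by blast
        then have "g * g dvd ?p q * ?r q" using gq by (simp add: mult_dvd_mono)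
        then show ?thesis using prk[of q] N q(1) by (intro exI[of _ "N * q"]) simp
      qed
      then show False using square_dvd_x_pow_minus_one_imp_unit g(1)
        by (metis prime_elem_not_unit)
    qed
    moreover have "?p q dvd pcompose (?p k) (monom 1 q)" "h dvd pcompose (?p k) (monom 1 q)"
    proof -
      show "?p q dvd pcompose (?p k) (monom 1 q)" unfolding h pcompose_mult by simp
      have "?p k dvd pcompose (?p q) (monom 1 k)" unfolding p' pcompose_mult by simp
      then have "h dvd pcompose (?p q) (monom 1 k)" unfolding h by (rule dvd_mult_right)
      then show "h dvd pcompose (?p k) (monom 1 q)" by (simp only: pcompose_monom_comm[of p k q])
    qed
    ultimately have "?p q * h dvd pcompose (?p q) (monom 1 k)"
      unfolding pcompose_monom_comm[of p k q] by (intro divides_mult)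
    then have "(p * h) * p' dvd (p * h) * pcompose p' (monom 1 k)"
      unfolding p' pcompose_mult h by (simp add: ac_simps)
    moreover have "p * h \<noteq> 0" using h prk[of k] N k(1) x_pow_minus_one_neq_0[of "N * k"] by fastforce
    ultimately show ?thesis using dvd_mult_cancel_left by blast
  qed
  moreover have "pcompose r (monom 1 q) * p dvd pcompose (pcompose r (monom 1 q) * p) (monom 1 k)"
    if k: "k > 0" "coprime k (N * q)" for k
    using pcompose_dvd[OF rd[of k], of "monom 1 q"] pd[of k] k
    unfolding pcompose_mult pcompose_monom_comm[of r q k] by (intro mult_dvd_mono) auto
  moreover have "p' * (pcompose r (monom 1 q) * p) = x_pow_minus_one (N * q)"
    using prk[of q] unfolding p' by (metis mult.assoc mult.commute)
  ultimately have "split_x_pow (N * q) p' (pcompose r (monom 1 q) * p)"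
    by (simp add: split_x_pow_def)
  then show thesis by (rule that[OF p'[symmetric]])
qed

subsection \<open>Unitary divisors and the polynomial quotient\<close>

text \<open>Each step splits off the full power of one prime, so the cofactor is coprime to it, as
  the recursions for unitary divisors require.\<close>

lemma coprime_primepow_induct [consumes 1, case_names one mult]:
  assumes "n > 0" "P 1"
    and "\<And>n q. n > 0 \<Longrightarrow> primepow q \<Longrightarrow> coprime q n \<Longrightarrow> P n \<Longrightarrow> P (n * q)"
  shows "P (n::nat)"
  using \<open>n > 0\<close>
proof (induction n rule: less_induct)
  case (less n)
  show ?case
  proof (cases "n = 1")
    case False
    then obtain p where p: "prime p" "p dvd n" using prime_factor_nat by blast
    let ?e = "multiplicity p n"
    have e: "?e > 0" using p less.prems by (simp add: prime_multiplicity_gt_zero_iff)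
    obtain k where k: "n = p ^ ?e * k" "\<not> p dvd k"
      by (rule multiplicity_decompose'[of n p]) (use p less.prems not_prime_unit in auto)
    have "1 < p ^ ?e" using prime_gt_1_nat[OF p(1)] e by (rule one_less_power)
    moreover have "k > 0" using k less.prems by (cases k) auto
    ultimately have "k < n" using k(1) by (metis mult_less_cancel2 nat_mult_1)
    then have "P k" using less.IH \<open>k > 0\<close> by blast
    moreover have "primepow (p ^ ?e)" using e p(1) by (auto simp: primepow_def)
    moreover have "coprime (p ^ ?e) k" using k(2) p(1) by (simp add: prime_imp_coprime)
    ultimately show ?thesis using assms(3) \<open>k > 0\<close> k(1) by (metis mult.commute)
  qed (use assms in simp)
qed

lemma finite_unitary_divisors: "n > 0 \<Longrightarrow> finite (unitary_divisors n)"
  by (rule finite_subset[of _ "{d. d dvd n}"]) (auto simp: unitary_divisors_def)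

text \<open>The part \<open>b\<close> of a unitary divisor that lies in \<open>q\<close> is coprime
  to \<open>q'\<close>, where \<open>q = b * q'\<close>. Both are powers of one prime, so one of
  them is 1.\<close>

lemma unitary_divisors_mult_primepow:
  assumes "n > 0" "primepow q" "coprime q n"
  shows "unitary_divisors (n * q) = unitary_divisors n \<union> (\<lambda>d. d * q) ` unitary_divisors n"
proof (intro Set.equalityI subsetI)
  have q0: "q > 0" using assms(2) primepow_gt_0_nat by blast
  fix d assume "d \<in> unitary_divisors (n * q)"
  then have d: "d dvd n * q" "coprime d (n * q div d)" by (auto simp: unitary_divisors_def)
  obtain a b where ab: "d = a * b" "a dvd n" "b dvd q" using d(1) division_decomp by metis
  obtain n' where n': "n = a * n'" using ab(2) by (elim dvdE)
  obtain q' where q': "q = b * q'" using ab(3) by (elim dvdE)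
  have pos: "a > 0" "b > 0" using n' q' assms(1) q0 by auto
  have "n * q div d = n' * q'" unfolding ab(1) n' q' using pos
    by (metis mult.assoc mult.left_commute mult_is_0 neq0_conv nonzero_mult_div_cancel_left)
  then have cop: "coprime a n'" "coprime b q'" using d(2) ab(1) by auto
  have a: "a \<in> unitary_divisors n" using cop n' pos by (simp add: unitary_divisors_def)
  obtain p e where p: "prime p" "q = p ^ e" using assms(2) by (auto simp: primepow_def)
  obtain i j where ij: "b = p ^ i" "q' = p ^ j" using p q' prime_power_mult_nat by metis
  have "i = 0 \<or> j = 0" using cop(2) p(1) unfolding ij
    by (metis coprime_power_left_iff coprime_power_right_iff coprime_self not_prime_unit neq0_conv)
  then have "b = 1 \<or> b = q" using ij q' by auto
  then show "d \<in> unitary_divisors n \<union> (\<lambda>d. d * q) ` unitary_divisors n" using ab(1) a by auto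
next
  have q0: "q > 0" using assms(2) primepow_gt_0_nat by blast
  fix d assume "d \<in> unitary_divisors n \<union> (\<lambda>d. d * q) ` unitary_divisors n"
  then obtain a where a: "a dvd n" "coprime a (n div a)" "d = a \<or> d = a * q"
    by (auto simp: unitary_divisors_def)
  obtain n' where n': "n = a * n'" using a(1) by (elim dvdE)
  have "a > 0" using n' assms(1) by auto
  then show "d \<in> unitary_divisors (n * q)" using a assms(3) n' q0
    by (auto simp: unitary_divisors_def coprime_commute mult.assoc)
qed

lemma num_prime_factors_mult_primepow:
  fixes n :: nat
  assumes "n > 0" "primepow q" "coprime q n"
  shows "num_prime_factors (n * q) = Suc (num_prime_factors n)"
proof -
  obtain p e where p: "prime p" "e > 0" "q = p ^ e" using assms(2) by (auto simp: primepow_def)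
  have "prime_factors (n * q) = insert p (prime_factors n)"
    using assms(1) p
    by (auto simp: prime_factors_product prime_factorization_prime_power prime_gt_0_nat)
  moreover have "p \<notin> prime_factors n"
    using assms(3) p by (auto simp: in_prime_factors_iff prime_imp_coprime_nat coprime_absorb_left)
  ultimately show ?thesis by (simp add: num_prime_factors_def)
qed

lemma mu_unitary_mult_primepow:
  "n > 0 \<Longrightarrow> primepow q \<Longrightarrow> coprime q n \<Longrightarrow> mu_unitary (n * q) = - mu_unitary n"
  by (simp add: mu_unitary_def num_prime_factors_mult_primepow)

lemma mu_unitary_cases: "mu_unitary n = 1 \<or> mu_unitary n = -1"
  by (auto simp: mu_unitary_def minus_one_power_iff)

lemma mu_unitary_1: "mu_unitary 1 = 1"
  by (simp add: mu_unitary_def num_prime_factors_def)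

text \<open>The numerator (\<open>s = 1\<close>) and the denominator (\<open>s = -1\<close>) of the defining product.\<close>
definition unitary_part :: "int \<Rightarrow> nat \<Rightarrow> int poly" where
  "unitary_part s n = (\<Prod>d | d \<in> unitary_divisors n \<and> mu_unitary (n div d) = s. x_pow_minus_one d)"

text \<open>A divisor \<open>d\<close> of \<open>n\<close> has the cofactor
  \<open>(n div d) * q\<close> in \<open>n * q\<close>, with one more prime and the opposite sign.
  The divisor \<open>d * q\<close> keeps the cofactor \<open>n div d\<close>, and its polynomial
  arises from that of \<open>d\<close> by x -> x^q.\<close>

lemma unitary_part_mult_primepow:
  assumes "n > 0" "primepow q" "coprime q n"
  shows "unitary_part s (n * q) = unitary_part (- s) n * pcompose (unitary_part s n) (monom 1 q)"
proof -
  have q1: "q > 1" using assms(2) primepow_gt_Suc_0 by auto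
  let ?U = "\<lambda>s n. {d. d \<in> unitary_divisors n \<and> mu_unitary (n div d) = s}"
  have fin: "finite (?U s n)" for s using finite_unitary_divisors[OF assms(1)] by simp
  have mu: "mu_unitary (n * q div d) = - mu_unitary (n div d)" if "d \<in> unitary_divisors n" for d
  proof -
    obtain k where k: "n = d * k" using \<open>d \<in> _\<close> by (auto simp: unitary_divisors_def)
    then have pos: "d > 0" "k > 0" using assms(1) by auto
    have "coprime q k" using assms(3) k by simp
    then show ?thesis using mu_unitary_mult_primepow[of k q] pos assms(2) k by (simp add: mult.assoc)
  qed
  have "?U s (n * q) = ?U (- s) n \<union> (\<lambda>d. d * q) ` ?U s n"
    unfolding unitary_divisors_mult_primepow[OF assms] using mu q1 by (auto simp: image_iff)
  moreover have "?U (- s) n \<inter> (\<lambda>d. d * q) ` ?U s n = {}"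
  proof -
    have "\<not> d * q dvd n" for d
    proof
      assume "d * q dvd n"
      then have "q dvd n" by (rule dvd_mult_right)
      then show False using assms(3) q1 by (metis coprime_absorb_left nat_dvd_1_iff_1 less_irrefl)
    qed
    then show ?thesis by (auto simp: unitary_divisors_def)
  qed
  moreover have "inj_on (\<lambda>d. d * q) (?U s n)" using q1 by (auto simp: inj_on_def)
  ultimately show ?thesis
    unfolding unitary_part_def using fin
    by (simp add: prod.union_disjoint prod.reindex pcompose_prod pcompose_x_pow_minus_one)
qed

lemma unitary_part_1: "unitary_part 1 1 = x_pow_minus_one 1" "unitary_part (- 1) 1 = 1"
proof -
  have *: "d \<in> unitary_divisors 1 \<and> mu_unitary (1 div d) = s \<longleftrightarrow> d = 1 \<and> s = 1" for d s
    using mu_unitary_1 by (auto simp: unitary_divisors_def)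
  show "unitary_part 1 1 = x_pow_minus_one 1" "unitary_part (- 1) 1 = 1"
    unfolding unitary_part_def * by simp_all
qed

lemma unitary_part_neq_0:
  assumes "n > 0"
  shows "unitary_part s n \<noteq> 0"
proof -
  have "d > 0" if "d \<in> unitary_divisors n" for d
    using that assms by (auto simp: unitary_divisors_def intro: Nat.gr0I)
  then show ?thesis
    using finite_unitary_divisors[OF assms] x_pow_minus_one_neq_0 by (auto simp: unitary_part_def)
qed

section \<open>The defining quotient as a polynomial\<close>

lemma unitary_cyclotomic_fract_eq:
  assumes "n > 0"
  shows "unitary_cyclotomic_fract n = to_fract (unitary_part 1 n) / to_fract (unitary_part (- 1) n)"
proof -
  let ?U = "\<lambda>s. {d. d \<in> unitary_divisors n \<and> mu_unitary (n div d) = s}"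
  let ?f = "\<lambda>d. to_fract (x_pow_minus_one d) powi mu_unitary (n div d)"
  have tp: "to_fract (\<Prod>x\<in>A. f x) = (\<Prod>x\<in>A. to_fract (f x))" for A and f :: "nat \<Rightarrow> int poly"
    by (induction A rule: infinite_finite_induct) auto
  have fin: "finite (?U s)" for s using finite_unitary_divisors[OF assms] by simp
  have "unitary_divisors n = ?U 1 \<union> ?U (- 1)" using mu_unitary_cases by auto
  then have "unitary_cyclotomic_fract n = prod ?f (?U 1 \<union> ?U (- 1))"
    unfolding unitary_cyclotomic_fract_def by simp
  also have "\<dots> = prod ?f (?U 1) * prod ?f (?U (- 1))"
    using fin by (intro prod.union_disjoint) auto
  also have "prod ?f (?U 1) = to_fract (unitary_part 1 n)"
    by (simp add: unitary_part_def tp)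
  also have "prod ?f (?U (- 1)) = inverse (to_fract (unitary_part (- 1) n))"
    by (simp add: unitary_part_def tp power_int_minus prod_inversef[symmetric])
  finally show ?thesis by (simp add: divide_inverse)
qed

text \<open>Replaces the quotient of fractions by a product of polynomials; injectivity of
  \<open>to_fract\<close> gives the uniqueness behind \<open>THE\<close>.\<close>

lemma unitary_cyclotomic_eqI:
  assumes "n > 0" "unitary_part 1 n = unitary_part (- 1) n * p"
  shows "unitary_cyclotomic n = p"
proof -
  have "to_fract p = unitary_cyclotomic_fract n"
    unfolding unitary_cyclotomic_fract_eq[OF assms(1)] assms(2)
    using unitary_part_neq_0[OF assms(1)] by simp
  then show ?thesis unfolding unitary_cyclotomic_def by (metis (mono_tags, lifting) the_equality to_fract_eq_iff)
qed

text \<open>From \<open>n\<close> to \<open>n * q\<close> the quotient p of numerator and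
  denominator becomes p(x^q) / p. The invariant \<open>split_x_pow\<close> keeps this division
  exact, and also makes the quotient a factor of x^n - 1.\<close>

lemma unitary_part_split:
  assumes "n > 0"
  shows "\<exists>p r. unitary_part 1 n = unitary_part (- 1) n * p \<and> split_x_pow n p r"
  using assms
proof (induction n rule: coprime_primepow_induct)
  case one
  have "split_x_pow 1 (x_pow_minus_one 1) 1"
    unfolding split_x_pow_def using x_pow_minus_one_dvd_mult[of 1]
    by (simp add: pcompose_x_pow_minus_one pcompose_1)
  then show ?case unfolding unitary_part_1 mult_1 by blast
next
  case (mult n q)
  then obtain p r where p: "unitary_part 1 n = unitary_part (- 1) n * p" "split_x_pow n p r" by blast
  have "q > 0" using mult.hyps primepow_gt_0_nat by blast
  then obtain p' where p': "p * p' = pcompose p (monom 1 q)"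
    "split_x_pow (n * q) p' (pcompose r (monom 1 q) * p)"
    using split_x_pow_mult[OF mult.hyps(1) _ mult.hyps(3) p(2)] by blast
  have "unitary_part 1 (n * q) = unitary_part (- 1) (n * q) * p'"
    using mult.hyps by (simp add: unitary_part_mult_primepow p(1) pcompose_mult p'(1)[symmetric] ac_simps)
  then show ?case using p'(2) by blast
qed

lemma unitary_cyclotomic_mult_inverse:
  assumes "n > 0"
  shows "unitary_cyclotomic n * inverse_unitary_cyclotomic n = x_pow_minus_one n"
proof -
  obtain p r where p: "unitary_part 1 n = unitary_part (- 1) n * p" "split_x_pow n p r"
    using unitary_part_split[OF assms] by blast
  then have "unitary_cyclotomic n = p" using unitary_cyclotomic_eqI assms by blast
  then have "unitary_cyclotomic n dvd x_pow_minus_one n"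
    using p(2) by (metis dvd_triv_left split_x_pow_def)
  then show ?thesis by (simp add: inverse_unitary_cyclotomic_def)
qed

text \<open>Quotient of the recursions for numerator and denominator, with the common nonzero factor
  \<open>?B * ?B'\<close> cancelled.\<close>

lemma unitary_cyclotomic_mult_primepow:
  assumes "n > 0" "primepow q" "coprime q n"
  shows "unitary_cyclotomic (n * q) * unitary_cyclotomic n
           = pcompose (unitary_cyclotomic n) (monom 1 q)"
proof -
  have q: "q > 0" using assms(2) primepow_gt_0_nat by blast
  have *: "unitary_part 1 n = unitary_part (- 1) n * unitary_cyclotomic n" if "n > 0" for n
    using unitary_part_split[OF that] unitary_cyclotomic_eqI[OF that] by metis
  let ?B = "unitary_part (- 1) n" and ?P = "unitary_cyclotomic n"
  let ?B' = "pcompose ?B (monom 1 q)"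
  have "(?B * ?B') * pcompose ?P (monom 1 q) = unitary_part 1 (n * q)"
    using assms *[OF assms(1)] by (simp add: unitary_part_mult_primepow pcompose_mult ac_simps)
  also have "\<dots> = (?B * ?B') * (unitary_cyclotomic (n * q) * ?P)"
    using assms *[OF assms(1)] *[of "n * q"] q by (simp add: unitary_part_mult_primepow ac_simps)
  finally show ?thesis
    using unitary_part_neq_0[of "n * q" "-1"] unitary_part_neq_0[of n "-1"] unitary_part_neq_0[of n "1"] assms(1) q
      unitary_part_mult_primepow[OF assms, of "-1"] by auto
qed

lemma pcompose_monom_expand:
  fixes p :: "'a::comm_ring_1 poly"
  shows "\<exists>s. pcompose p (monom 1 q) = [:coeff p 0:] + monom (coeff p 1) q + monom 1 (2 * q) * s"
proof -
  obtain a b r where p: "p = pCons a (pCons b r)" by (metis pCons_cases)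
  have "pcompose p (monom 1 q) = [:a:] + monom 1 q * [:b:] + (monom 1 q * monom 1 q) * pcompose r (monom 1 q)"
    unfolding p by (simp add: pcompose_pCons algebra_simps)
  moreover have "monom 1 q * monom 1 q = (monom 1 (2 * q) :: 'a poly)" by (simp add: mult_monom mult_2)
  moreover have "monom 1 q * [:b:] = monom b q" by (simp add: mult.commute smult_monom)
  ultimately show ?thesis unfolding p by auto
qed

text \<open>Compare the two lowest coefficients in P_(n q) P_n = P_n(x^q); the one at 1 vanishes on
  the right since q > 1. The case n = 1 is exceptional because P_1 = x - 1.\<close>

lemma coeff_unitary_cyclotomic:
  assumes "n > 0"
  shows "coeff (unitary_cyclotomic n) 0 = (if n = 1 then - 1 else 1) \<and>
         coeff (unitary_cyclotomic n) 1 = (if n = 1 then 1 else - mu_unitary n)"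
  using assms
proof (induction n rule: coprime_primepow_induct)
  case one
  have "unitary_cyclotomic 1 = x_pow_minus_one 1"
    by (intro unitary_cyclotomic_eqI) (simp_all add: unitary_part_1[simplified])
  then show ?case by (simp add: x_pow_minus_one_def)
next
  case (mult n q)
  have q1: "q > 1" using mult.hyps primepow_gt_Suc_0 by auto
  let ?P = "unitary_cyclotomic n" and ?P' = "unitary_cyclotomic (n * q)"
  have eq: "?P' * ?P = pcompose ?P (monom 1 q)" using mult.hyps unitary_cyclotomic_mult_primepow by blast
  obtain s where s: "pcompose ?P (monom 1 q) = [:coeff ?P 0:] + monom (coeff ?P 1) q + monom 1 (2 * q) * s"
    using pcompose_monom_expand by blast
  have "coeff (?P' * ?P) 0 = coeff ?P 0" "coeff (?P' * ?P) 1 = 0"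
    unfolding eq s using q1 by (auto simp: coeff_monom_mult coeff_pCons split: nat.splits)
  then have c: "coeff ?P' 0 * coeff ?P 0 = coeff ?P 0"
    "coeff ?P' 0 * coeff ?P 1 + coeff ?P' 1 * coeff ?P 0 = 0"
    by (auto simp: coeff_mult)
  have "coeff ?P 0 \<noteq> 0" using mult.IH by auto
  then have "coeff ?P' 0 = 1" using c(1) by simp
  moreover have "coeff ?P' 1 = mu_unitary n"
    using c(2) mult.IH mu_unitary_1 calculation by (auto split: if_splits)
  ultimately show ?case using mult.hyps q1 by (simp add: mu_unitary_mult_primepow)
qed

subsection \<open>Clusters of prime powers\<close>

lemma ex_power_cong_1:
  fixes a m :: nat
  assumes "coprime a m" "m > 0"
  obtains e where "e > 0" "[a ^ e = 1] (mod m)"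
proof -
  have "finite (range (\<lambda>k. a ^ k mod m))"
    by (rule finite_subset[of _ "{..<m}"]) (use assms(2) in auto)
  then have "\<not> inj (\<lambda>k. a ^ k mod m)" using finite_imageD infinite_UNIV_nat by blast
  then obtain i j where ij: "a ^ i mod m = a ^ j mod m" "i < j"
    unfolding inj_on_def by (metis nat_neq_iff)
  then have "[a ^ i * a ^ (j - i) = a ^ i * 1] (mod m)"
    by (simp add: cong_def flip: power_add)
  then have "[a ^ (j - i) = 1] (mod m)"
    using assms(1) by (metis cong_mult_lcancel_nat coprime_power_left_iff)
  then show ?thesis using that[of "j - i"] ij(2) by simp
qed

text \<open>The powers \<open>p i ^ (e i * nat (h i))\<close> have logarithms within 1/4 of one
  common integer \<open>k\<close>. The exponent \<open>e i\<close> secures the congruence whatever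
  \<open>h i\<close> is, which leaves \<open>h i\<close> free for the approximation.\<close>

lemma ex_clustered_primepows:
  fixes m t :: nat
  assumes "m > 0"
  obtains Q :: "nat set" where "finite Q" "card Q = t" "\<And>q. q \<in> Q \<Longrightarrow> primepow q"
    "\<And>q. q \<in> Q \<Longrightarrow> [q = 1] (mod m)"
    "pairwise coprime Q" "\<And>q q'. q \<in> Q \<Longrightarrow> q' \<in> Q \<Longrightarrow> q < 2 * q'"
proof -
  have "infinite {p::nat. prime p \<and> m < p}"
    by (metis (mono_tags, lifting) bigger_prime infinite_nat_iff_unbounded max.strict_boundedE mem_Collect_eq)
  then obtain T where T: "finite T" "card T = t" "T \<subseteq> {p. prime p \<and> m < p}"
    using infinite_arbitrarily_large by blast
  obtain p where p: "bij_betw p {..<t} T"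
    using ex_bij_betw_nat_finite[OF T(1)] T(2) by (metis atLeast0LessThan)
  have prime: "prime (p i)" "m < p i" if "i < t" for i using p T(3) that by (auto simp: bij_betw_def)
  have "\<exists>e. e > 0 \<and> [p i ^ e = 1] (mod m)" if "i < t" for i
  proof -
    have "coprime (p i) m"
      using prime[OF that] assms by (intro prime_imp_coprime) (auto dest: dvd_imp_le)
    then show ?thesis using ex_power_cong_1 assms by metis
  qed
  then obtain e where e: "\<And>i. i < t \<Longrightarrow> e i > 0 \<and> [p i ^ e i = 1] (mod m)" by metis
  \<comment> \<open>\<open>c i\<close> is the logarithm of \<open>p i ^ e i\<close>; the integers
    \<open>h i\<close> sought are close to \<open>k / c i\<close>.\<close>
  define c where "c i = real (e i) * ln (real (p i))" for i
  have c_pos: "c i > 0" if "i < t" for i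
    using e[OF that] prime_gt_1_nat[OF prime(1)[OF that]] by (simp add: c_def)
  \<comment> \<open>Multiplying by \<open>c i\<close> turns an error below \<open>1 / N\<close> into
    one below 1/4.\<close>
  obtain N :: nat where N: "(\<Sum>i<t. 4 * c i) < real N" using reals_Archimedean2 by blast
  have cN: "4 * c i < real N" if "i < t" for i
  proof -
    have "4 * c i \<le> (\<Sum>i<t. 4 * c i)" using that c_pos by (intro member_le_sum) (auto intro: less_imp_le)
    then show ?thesis using N by simp
  qed
  have N0: "N > 0"
  proof -
    have "0 \<le> (\<Sum>i<t. 4 * c i)" using c_pos by (intro sum_nonneg) (auto intro: less_imp_le)
    then show ?thesis using N by simp
  qed
  obtain k h where k: "0 < k" and h: "\<And>i. i < t \<Longrightarrow> \<bar>of_int k * (1 / c i) - of_int (h i)\<bar> < 1 / N"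
    using Dirichlet_approx_simult[OF N0, of t "\<lambda>i. 1 / c i"] by metis
  have hc: "\<bar>of_int k - of_int (h i) * c i\<bar> < 1 / 4" if "i < t" for i
  proof -
    have "\<bar>of_int k - of_int (h i) * c i\<bar> = \<bar>of_int k * (1 / c i) - of_int (h i)\<bar> * c i"
    proof -
      have "of_int k * (1 / c i) - of_int (h i) = (of_int k - of_int (h i) * c i) / c i"
        using c_pos[OF that] by (simp add: field_simps)
      then show ?thesis using c_pos[OF that] by (simp add: abs_divide)
    qed
    also have "\<dots> < 1 / N * c i" using h[OF that] c_pos[OF that] by (rule mult_strict_right_mono)
    also have "\<dots> < 1 / 4" using cN[OF that] N0 by (simp add: field_simps)
    finally show ?thesis .
  qed
  have h_pos: "h i > 0" if "i < t" for i
  proof -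
    have "of_int (h i) * c i > 0" using hc[OF that] k by linarith
    then show ?thesis using c_pos[OF that] by (simp add: zero_less_mult_iff)
  qed
  define q where "q i = p i ^ (e i * nat (h i))" for i
  have ln_q: "ln (real (q i)) = of_int (h i) * c i" if "i < t" for i
    using h_pos[OF that] prime_gt_0_nat[OF prime(1)[OF that]] by (simp add: q_def c_def ln_realpow)
  have primepow: "primepow (q i)" if "i < t" for i
    using prime(1)[OF that] e[OF that] h_pos[OF that] unfolding primepow_def q_def
    by (intro exI[of _ "p i"] exI[of _ "e i * nat (h i)"]) simp
  have cop: "coprime (q i) (q j)" if "i < t" "j < t" "i \<noteq> j" for i j
  proof -
    have "p i \<noteq> p j" using p that by (auto simp: bij_betw_def inj_on_def)
    then show ?thesis using prime that by (simp add: q_def primes_coprime)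
  qed
  have inj: "inj_on q {..<t}"
  proof (rule inj_onI, rule ccontr)
    fix i j assume "i \<in> {..<t}" "j \<in> {..<t}" "q i = q j" "i \<noteq> j"
    then have "q i = 1" using cop[of i j] by simp
    then show False using primepow[of i] \<open>i \<in> {..<t}\<close> by (auto dest: primepow_gt_Suc_0)
  qed
  have q2: "q i < 2 * q j" if "i < t" "j < t" for i j
  proof -
    have pos: "q i > 0" "q j > 0" using primepow that primepow_gt_0_nat by blast+
    \<comment> \<open>Two logarithms within 1/4 of \<open>k\<close> differ by less than 1/2, so ln 2
      \<ge> 1/2 bounds the ratio by 2.\<close>
    have "1 / 2 \<le> ln (2::real)" using ln_le_minus_one[of "1 / 2 :: real"] by (simp add: ln_div)
    then have "ln (real (q i)) < ln 2 + ln (real (q j))"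
      using hc[OF that(1)] hc[OF that(2)] ln_q[OF that(1)] ln_q[OF that(2)] by linarith
    also have "\<dots> = ln (real (2 * q j))" using pos by (simp add: ln_mult)
    finally show ?thesis using pos by simp
  qed
  have cong: "[q i = 1] (mod m)" if "i < t" for i
    using e[OF that] cong_pow[of "p i ^ e i" 1 m "nat (h i)"] by (simp add: q_def power_mult)
  show thesis
  proof (rule that[of "q ` {..<t}"])
    show "pairwise coprime (q ` {..<t})" using cop by (auto simp: pairwise_def)
  qed (use inj primepow cong q2 in \<open>auto simp: card_image\<close>)
qed

subsection \<open>Adjoining clustered prime powers\<close>

text \<open>Division in the quotient ring modulo \<open>x\<close>: \<open>v\<close> inverts
  \<open>u\<close>, hence also \<open>p\<close>.\<close>

lemma dvd_diff_mult_if_inverse: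
  fixes p p' u v w x :: "'a::comm_ring_1"
  assumes "x dvd u * v - 1" "x dvd p - u" "x dvd p' * p - w"
  shows "x dvd p' - v * w"
proof -
  have "p' - v * w = v * (p' * p - w) - v * p' * (p - u) - p' * (u * v - 1)"
    by (simp add: algebra_simps)
  then show ?thesis using assms by simp
qed

lemma monom_1_dvd_monom: "l \<le> k \<Longrightarrow> monom (1::'a::comm_ring_1) l dvd monom c k"
  by (auto simp: monom_1_dvd_iff')

text \<open>The product is P_n(x^q), whose terms after the first two are multiples of x^(2 q) and
  vanish modulo x^l.\<close>

lemma unitary_cyclotomic_mult_primepow_cong:
  assumes "n > 1" "primepow q" "coprime q n" "l \<le> 2 * q"
  shows "monom 1 l dvd unitary_cyclotomic (n * q) * unitary_cyclotomic n - (1 - [:mu_unitary n:] * monom 1 q)"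
proof -
  obtain s where "unitary_cyclotomic (n * q) * unitary_cyclotomic n
      = [:1:] + monom (- mu_unitary n) q + monom 1 (2 * q) * s"
    using pcompose_monom_expand[of "unitary_cyclotomic n" q] coeff_unitary_cyclotomic[of n]
      unitary_cyclotomic_mult_primepow[of n q] assms by auto
  then have "unitary_cyclotomic (n * q) * unitary_cyclotomic n - (1 - [:mu_unitary n:] * monom 1 q)
      = monom 1 (2 * q) * s"
    by (simp add: smult_monom minus_monom[symmetric])
  then show ?thesis using monom_1_dvd_monom[OF assms(4), of "1::int"] by simp
qed

lemma mu_unitary_mult_prod_primepow:
  assumes "m > 0" "finite Q" "\<And>q. q \<in> Q \<Longrightarrow> primepow q \<and> coprime q m" "pairwise coprime Q"
  shows "m * \<Prod>Q > 0 \<and> mu_unitary (m * \<Prod>Q) = (- 1) ^ card Q * mu_unitary m"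
  using assms(2,3,4)
proof (induction Q rule: finite_induct)
  case (insert q Q)
  have q: "primepow q" "coprime q (m * \<Prod>Q)"
    using insert.prems insert.hyps by (auto simp: pairwise_insert intro!: prod_coprime_right)
  have IH: "m * \<Prod>Q > 0" "mu_unitary (m * \<Prod>Q) = (- 1) ^ card Q * mu_unitary m"
    using insert by (auto simp: pairwise_insert)
  have "m * \<Prod>Q * q > 0" using IH(1) primepow_gt_0_nat[OF q(1)] by simp
  moreover have "mu_unitary (m * \<Prod>Q * q) = - mu_unitary (m * \<Prod>Q)"
    using mu_unitary_mult_primepow IH(1) q by blast
  ultimately show ?case using insert.hyps IH(2) by (simp add: ac_simps)
qed (use assms in auto)

text \<open>Adjoining one more \<open>q\<close> divides 1 -+ \<open>[:mu_unitary m:]\<close> x^q by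
  the previous polynomial. As \<open>u\<close> and \<open>v\<close> are inverse to each other modulo
  x^l, this exchanges them. They depend on a set since the induction runs over subsets of
  \<open>Q\<close>.\<close>

lemma unitary_cyclotomic_mult_prod_cong:
  assumes m: "m > 1" and Q: "finite Q" "\<And>q. q \<in> Q \<Longrightarrow> primepow q \<and> coprime q m" "pairwise coprime Q"
    and l: "\<And>q. q \<in> Q \<Longrightarrow> l \<le> 2 * q" and b: "monom 1 l dvd b * unitary_cyclotomic m - 1"
  defines "u \<equiv> \<lambda>Q. unitary_cyclotomic m * (1 + [:mu_unitary m:] * (\<Sum>q\<in>Q. monom 1 q))"
    and "v \<equiv> \<lambda>Q. b * (1 - [:mu_unitary m:] * (\<Sum>q\<in>Q. monom 1 q))"
  shows "monom 1 l dvd u Q * v Q - 1"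
    and "monom 1 l dvd unitary_cyclotomic (m * \<Prod>Q) - (if even (card Q) then u Q else v Q)"
proof -
  let ?e = "[:mu_unitary m:]" and ?S = "\<lambda>Q. \<Sum>q\<in>Q. monom 1 q :: int poly"
  have ee: "?e * ?e = 1" using mu_unitary_cases[of m] by auto
  have SS: "monom 1 l dvd monom 1 q * ?S Q'" if "Q' \<subseteq> Q" "q \<in> Q" for q Q'
  proof -
    \<comment> \<open>Half the sum of the bounds for \<open>q\<close> and \<open>r\<close>: products
      of two of the monomials vanish modulo x^l.\<close>
    have "l \<le> q + r" if "r \<in> Q'" for r
      using l[of q] l[of r] that \<open>Q' \<subseteq> Q\<close> \<open>q \<in> Q\<close> by force
    then show ?thesis unfolding sum_distrib_left mult_monom by (intro dvd_sum monom_1_dvd_monom) simp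
  qed
  have uv: "monom 1 l dvd u Q' * v Q' - 1" if "Q' \<subseteq> Q" for Q'
  proof -
    have S: "monom 1 l dvd ?S Q' * ?S Q'"
      unfolding sum_distrib_right[of _ Q' "?S Q'"] using SS that by (intro dvd_sum) blast
    have "u Q' * v Q' - 1 = (b * unitary_cyclotomic m - 1) * (1 - (?e * ?e) * (?S Q' * ?S Q')) - (?e * ?e) * (?S Q' * ?S Q')"
      unfolding u_def v_def by (simp only: ring_distribs) (simp add: algebra_simps)
    then show ?thesis using b S by (simp only: dvd_diff dvd_mult dvd_mult2)
  qed
  show "monom 1 l dvd u Q * v Q - 1" using uv by simp
  have "monom 1 l dvd unitary_cyclotomic (m * \<Prod>Q') - (if even (card Q') then u Q' else v Q')" if "Q' \<subseteq> Q" for Q'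
    using finite_subset[OF that Q(1)] that
  proof (induction Q' rule: finite_induct)
    case empty
    then show ?case by (simp add: u_def)
  next
    case (insert q Q')
    have sub: "q \<in> Q" "Q' \<subseteq> Q" using insert.prems by auto
    have pw: "pairwise coprime (insert q Q')" using Q(3) insert.prems by (rule pairwise_subset)
    then have facts: "m * \<Prod>Q' > 0" "mu_unitary (m * \<Prod>Q') = (- 1) ^ card Q' * mu_unitary m"
      using mu_unitary_mult_prod_primepow[of m Q'] m insert.hyps(1) Q(2) sub(2) by (auto simp: pairwise_insert)
    have "\<Prod>Q' \<ge> 1" using facts(1) by (simp add: Suc_le_eq)
    then have gt1: "1 < m * \<Prod>Q'" using m mult_le_mono2[of 1 "\<Prod>Q'" m] by linarith
    have "coprime q (m * \<Prod>Q')" using Q(2)[OF sub(1)] pw insert.hyps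
      by (auto simp: pairwise_insert intro!: prod_coprime_right)
    then have step: "monom 1 l dvd unitary_cyclotomic (m * \<Prod>(insert q Q')) * unitary_cyclotomic (m * \<Prod>Q')
        - (1 - [:mu_unitary (m * \<Prod>Q'):] * monom 1 q)"
      using unitary_cyclotomic_mult_primepow_cong[OF gt1 conjunct1[OF Q(2)[OF sub(1)]] _ l[OF sub(1)]]
      unfolding prod.insert[OF insert.hyps] by (simp only: mult.left_commute mult.commute)
    have S: "?S (insert q Q') = monom 1 q + ?S Q'" using insert.hyps by simp
    have IH: "monom 1 l dvd unitary_cyclotomic (m * \<Prod>Q') - (if even (card Q') then u Q' else v Q')"
      using insert.IH sub(2) by simp
    \<comment> \<open>Replaces the product form by the sum form, whose difference is a multiple of
      x^q times the old sum.\<close>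
    have trans: "x dvd a - c" if "x dvd a - b'" "b' - c = d * (monom 1 q * ?S Q')" "x = monom 1 l"
      for x a b' c d :: "int poly"
    proof -
      have "a - c = (a - b') + d * (monom 1 q * ?S Q')" using that(2) by (simp add: algebra_simps)
      then show ?thesis using SS[OF sub(2,1)] that(1,3) by (simp only: dvd_add dvd_mult)
    qed
    \<comment> \<open>The sign at \<open>m * \<Prod>Q'\<close> alternates with the parity too, so
      the new term always enters \<open>v\<close> with a minus and \<open>u\<close> with a
      plus.\<close>
    show ?case
    proof (cases "even (card Q')")
      case True
      have "monom 1 l dvd unitary_cyclotomic (m * \<Prod>(insert q Q')) - v Q' * (1 - ?e * monom 1 q)"
        using dvd_diff_mult_if_inverse[OF uv[OF sub(2)] _ step] IH facts(2) True by simp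
      moreover have "v Q' * (1 - ?e * monom 1 q) - v (insert q Q') = (b * (?e * ?e)) * (monom 1 q * ?S Q')"
        unfolding v_def S by (simp only: ring_distribs) (simp add: algebra_simps)
      ultimately have "monom 1 l dvd unitary_cyclotomic (m * \<Prod>(insert q Q')) - v (insert q Q')"
        by (rule trans) (rule refl)
      then show ?thesis using True insert.hyps by simp
    next
      case False
      have vu: "monom 1 l dvd v Q' * u Q' - 1" using uv[OF sub(2)] by (simp add: mult.commute)
      have "monom 1 l dvd unitary_cyclotomic (m * \<Prod>(insert q Q')) - u Q' * (1 + ?e * monom 1 q)"
        using dvd_diff_mult_if_inverse[OF vu _ step] IH facts(2) False by simp
      moreover have "u Q' * (1 + ?e * monom 1 q) - u (insert q Q') = (unitary_cyclotomic m * (?e * ?e)) * (monom 1 q * ?S Q')"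
        unfolding u_def S by (simp only: ring_distribs) (simp add: algebra_simps)
      ultimately have "monom 1 l dvd unitary_cyclotomic (m * \<Prod>(insert q Q')) - u (insert q Q')"
        by (rule trans) (rule refl)
      then show ?thesis using False insert.hyps by simp
    qed
  qed
  then show "monom 1 l dvd unitary_cyclotomic (m * \<Prod>Q) - (if even (card Q) then u Q else v Q)" by blast
qed

section \<open>The inverse power series and its periodic coefficients\<close>

lemma coeff_mult_monom: "coeff (p * monom c n) k = (if k < n then 0 else coeff p (k - n) * c)"
  for c :: "'a::comm_semiring_1"
  by (metis coeff_monom_mult mult.commute)

text \<open>Copies of \<open>p\<close> shifted by multiples of \<open>m\<close> do not overlap, as
  the degree is below \<open>m\<close>; at \<open>j\<close> only the copy with
  \<open>k = j div m\<close> contributes.\<close>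

lemma coeff_mult_sum_monom:
  fixes p :: "'a::comm_semiring_1 poly"
  assumes "degree p < m" "j div m < l"
  shows "coeff (p * (\<Sum>k<l. monom 1 (m * k))) j = coeff p (j mod m)"
proof -
  have "coeff (p * monom 1 (m * k)) j = (if k = j div m then coeff p (j mod m) else 0)" for k
  proof -
    consider "k = j div m" | "k < j div m" | "k > j div m" by linarith
    then show ?thesis
    proof cases
      case 1
      then show ?thesis using times_div_less_eq_dividend[of m j]
        by (simp add: coeff_mult_monom minus_mult_div_eq_mod leD)
    next
      case 2
      then have "m * (k + 1) \<le> m * (j div m)" by (intro mult_le_mono2) simp
      also have "\<dots> \<le> j" by simp
      finally have "m \<le> j - m * k" by simp
      then have "coeff p (j - m * k) = 0" using assms(1) by (intro coeff_eq_0) simp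
      then show ?thesis using 2 by (simp add: coeff_mult_monom)
    next
      case 3
      then have "j < m * k" using assms(1) by (metis div_less_iff_less_mult less_nat_zero_code mult.commute neq0_conv)
      then show ?thesis using 3 by (simp add: coeff_mult_monom)
    qed
  qed
  then show ?thesis using assms(2) by (simp add: sum_distrib_left coeff_sum)
qed

text \<open>From P R = x^m - 1 follows 1 / P = -R / (1 - x^m). The witness \<open>?b\<close>
  truncates this geometric series after \<open>l\<close> terms, so its coefficients below
  \<open>l\<close> repeat those of -R with period \<open>m\<close>.\<close>

lemma unitary_cyclotomic_inverse_cong:
  assumes "m > 1"
  obtains b where "monom 1 l dvd b * unitary_cyclotomic m - 1"
    "\<And>j. j < l \<Longrightarrow> j mod m = 0 \<Longrightarrow> coeff b j = 1"
    "\<And>j. j < l \<Longrightarrow> j mod m = 1 \<Longrightarrow> coeff b j = mu_unitary m"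
proof -
  let ?P = "unitary_cyclotomic m" and ?R = "inverse_unitary_cyclotomic m"
  let ?b = "- ?R * (\<Sum>k<l. monom 1 (m * k))"
  have PR: "?P * ?R = x_pow_minus_one m" using unitary_cyclotomic_mult_inverse assms by simp
  have P: "coeff ?P 0 = 1" "coeff ?P 1 = - mu_unitary m" using coeff_unitary_cyclotomic[of m] assms by auto
  have "coeff (?P * ?R) 0 = - 1" "coeff (?P * ?R) 1 = 0"
    unfolding PR using assms by (auto simp: x_pow_minus_one_def)
  then have R: "coeff ?R 0 = - 1" "coeff ?R 1 = - mu_unitary m"
    using P by (auto simp: coeff_mult)
  have "degree ?P + degree ?R = degree (?P * ?R)"
    using PR x_pow_minus_one_neq_0[of m] assms by (intro degree_mult_eq[symmetric]) auto
  also have "\<dots> \<le> m" unfolding PR x_pow_minus_one_def by (intro degree_diff_le) (auto simp: degree_monom_le)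
  \<comment> \<open>The coefficient of P at 1 is 1 or -1. This makes the degree of R strictly less
    than \<open>m\<close>, so the periods do not overlap.\<close>
  moreover have "degree ?P \<ge> 1" using P(2) mu_unitary_cases[of m] by (intro le_degree) auto
  ultimately have deg: "degree (- ?R) < m" by simp
  have c: "coeff ?b j = - coeff ?R (j mod m)" if "j < l" for j
    using coeff_mult_sum_monom[OF deg, of j l] that div_le_dividend[of j m] by simp
  have "(\<Sum>k<l. monom 1 (m * k)) = (\<Sum>k<l. monom 1 m ^ k :: int poly)"
    by (simp add: monom_power)
  then have "x_pow_minus_one m * (\<Sum>k<l. monom 1 (m * k)) = monom 1 (m * l) - 1"
    unfolding x_pow_minus_one_def by (metis power_diff_1_eq monom_power power_one)
  then have "?b * ?P - 1 = - monom 1 (m * l)"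
    unfolding PR[symmetric] by (simp add: algebra_simps)
  moreover have "monom 1 l dvd (monom 1 (m * l) :: int poly)" using assms by (intro monom_1_dvd_monom) simp
  ultimately have "monom 1 l dvd ?b * ?P - 1" by simp
  then show thesis using that[of ?b] c R by simp
qed

section \<open>Values attained by the coefficients\<close>

lemma ex_rank:
  fixes A :: "'a::linorder set"
  assumes "finite A" "1 \<le> s" "s \<le> card A"
  shows "\<exists>a\<in>A. card {x \<in> A. x \<le> a} = s"
  using assms
proof (induction A rule: finite_linorder_max_induct)
  case (insert b A)
  show ?case
  proof (cases "s \<le> card A")
    case True
    then obtain a where a: "a \<in> A" "card {x \<in> A. x \<le> a} = s" using insert by auto
    moreover have "{x \<in> insert b A. x \<le> a} = {x \<in> A. x \<le> a}" using insert.hyps a by force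
    ultimately show ?thesis by (intro bexI[of _ a]) simp_all
  next
    case False
    have "{x \<in> insert b A. x \<le> b} = insert b A" using insert.hyps by force
    moreover have "card (insert b A) = s" using False insert.prems insert.hyps by (auto simp: card_insert_if)
    ultimately show ?thesis by auto
  qed
qed simp

lemma coeff_eq_if_monom_dvd_diff:
  "monom (1::'a::comm_ring_1) l dvd p - r \<Longrightarrow> k < l \<Longrightarrow> coeff p k = coeff r k"
  by (simp add: monom_1_dvd_iff')

text \<open>Read off the coefficient of \<open>?v\<close> at the \<open>s\<close>-th smallest
  element q0 of \<open>Q\<close>: \<open>b\<close> has coefficient \<open>mu_unitary m\<close> at
  q0, and each of the \<open>s\<close> elements q \<le> q0 subtracts \<open>mu_unitary m\<close>
  times the coefficient 1 of \<open>b\<close> at q0 - q.\<close>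

lemma coeff_unitary_cyclotomic_attains:
  fixes m s :: nat
  assumes "m > 1" "s \<ge> 1"
  shows "\<exists>n\<ge>1. \<exists>j. coeff (unitary_cyclotomic (m * n)) j = mu_unitary m * (1 - int s)"
    and "\<exists>n\<ge>1. \<exists>j. coeff (inverse_unitary_cyclotomic (m * n)) j = mu_unitary m * (int s - 1)"
proof -
  \<comment> \<open>The parity of the cluster size \<open>t\<close> selects the polynomial or its
    inverse; in both cases the truncated series is \<open>?v\<close>.\<close>
  have main: "\<exists>n\<ge>1. \<exists>j. (if even t then - coeff (inverse_unitary_cyclotomic (m * n)) j
      else coeff (unitary_cyclotomic (m * n)) j) = mu_unitary m * (1 - int s)" if st: "s \<le> t" for t
  proof -
    obtain Q where Q: "finite Q" "card Q = t" "\<And>q. q \<in> Q \<Longrightarrow> primepow q" "\<And>q. q \<in> Q \<Longrightarrow> [q = 1] (mod m)"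
      "pairwise coprime Q" "\<And>q q'. q \<in> Q \<Longrightarrow> q' \<in> Q \<Longrightarrow> q < 2 * q'"
      using ex_clustered_primepows[of m t] assms(1) by auto
    have cop: "coprime q m" if "q \<in> Q" for q
      using Q(4)[OF that] by (metis cong_imp_coprime cong_sym coprime_1_left)
    obtain q0 where q0: "q0 \<in> Q" "card {q \<in> Q. q \<le> q0} = s" using ex_rank[OF Q(1) assms(2)] st Q(2) by blast
    \<comment> \<open>The largest truncation with \<open>l \<le> 2 * q\<close> on all of
      \<open>Q\<close>; clustering still puts every element of \<open>Q\<close> below it.\<close>
    define l where "l = 2 * Min Q"
    have l: "l \<le> 2 * q" "q < l" if "q \<in> Q" for q
    proof -
      have "Min Q \<in> Q" "Min Q \<le> q" using Q(1) that by (intro Min_in Min_le; blast)+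
      then show "l \<le> 2 * q" "q < l" using Q(6)[OF that] by (auto simp: l_def)
    qed
    obtain b where b: "monom 1 l dvd b * unitary_cyclotomic m - 1"
      "\<And>j. j < l \<Longrightarrow> j mod m = 0 \<Longrightarrow> coeff b j = 1"
      "\<And>j. j < l \<Longrightarrow> j mod m = 1 \<Longrightarrow> coeff b j = mu_unitary m"
      using unitary_cyclotomic_inverse_cong assms(1) by blast
    let ?v = "b * (1 - [:mu_unitary m:] * (\<Sum>q\<in>Q. monom 1 q))"
    let ?u = "unitary_cyclotomic m * (1 + [:mu_unitary m:] * (\<Sum>q\<in>Q. monom 1 q))"
    let ?N = "m * \<Prod>Q"
    have cong: "monom 1 l dvd ?u * ?v - 1"
      "monom 1 l dvd unitary_cyclotomic ?N - (if even (card Q) then ?u else ?v)"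
      using unitary_cyclotomic_mult_prod_cong[OF assms(1) Q(1) _ Q(5) l(1) b(1)] Q(3) cop by auto
    have mod1: "q mod m = 1" if "q \<in> Q" for q using Q(4)[OF that] assms(1) by (simp add: cong_def)
    have v: "coeff ?v q0 = mu_unitary m * (1 - int s)"
    proof -
      have "coeff (b * monom 1 q) q0 = (if q \<le> q0 then 1 else 0)" if "q \<in> Q" for q
      proof (cases "q \<le> q0")
        case True
        \<comment> \<open>Both are 1 modulo \<open>m\<close>, so \<open>b\<close> is evaluated at a
          multiple of \<open>m\<close>.\<close>
        then have "(q0 - q) mod m = 0" using mod1[OF that] mod1[OF q0(1)]
          by (metis mod_eq_dvd_iff_nat mod_0_imp_dvd dvd_imp_mod_0)
        then show ?thesis using True b(2)[of "q0 - q"] l(2)[OF q0(1)] by (simp add: coeff_mult_monom)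
      qed (simp add: coeff_mult_monom)
      then have "(\<Sum>q\<in>Q. coeff (b * monom 1 q) q0) = (\<Sum>q\<in>Q. if q \<le> q0 then 1 else 0)"
        by (intro sum.cong) auto
      also have "\<dots> = int s" using q0(2) Q(1) by (simp add: sum.If_cases Int_def)
      finally have S: "(\<Sum>q\<in>Q. coeff (b * monom 1 q) q0) = int s" .
      have "?v = b - smult (mu_unitary m) (\<Sum>q\<in>Q. b * monom 1 q)"
        by (simp add: algebra_simps sum_distrib_left)
      then have "coeff ?v q0 = coeff b q0 - mu_unitary m * (\<Sum>q\<in>Q. coeff (b * monom 1 q) q0)"
        by (simp add: coeff_sum)
      then show ?thesis using b(3)[OF l(2)[OF q0(1)] mod1[OF q0(1)]] S by (simp add: algebra_simps)
    qed
    have pos: "\<Prod>Q > 0" using Q(3) primepow_gt_0_nat by (intro prod_pos) blast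
    show ?thesis
    proof (cases "even t")
      case True
      have "q0 \<le> \<Prod>Q" using q0(1) Q(1) pos by (intro dvd_imp_le dvd_prodI) auto
      \<comment> \<open>Thus x^N vanishes modulo x^l for N = \<open>?N\<close>, and the negated
        inverse polynomial is an inverse of P_N there. Since P_N agrees with \<open>?u\<close>, this
        inverse agrees with \<open>?v\<close>.\<close>
      then have "l \<le> ?N" using l(1)[OF q0(1)] assms(1) by (metis Suc_leI le_trans mult_le_mono numeral_2_eq_2 One_nat_def)
      then have "monom 1 l dvd - inverse_unitary_cyclotomic ?N * unitary_cyclotomic ?N - 1"
        using unitary_cyclotomic_mult_inverse[of ?N] pos assms(1) monom_1_dvd_monom[of l ?N "1::int"]
        by (simp add: mult.commute x_pow_minus_one_def)
      moreover have "monom 1 l dvd unitary_cyclotomic ?N - ?u" using cong(2) True unfolding Q(2) by (simp only: if_True)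
      ultimately have "monom 1 l dvd - inverse_unitary_cyclotomic ?N - ?v * 1"
        by (intro dvd_diff_mult_if_inverse[OF cong(1)])
      then have "coeff (- inverse_unitary_cyclotomic ?N) q0 = coeff (?v * 1) q0"
        using coeff_eq_if_monom_dvd_diff l(2)[OF q0(1)] by blast
      then show ?thesis using v pos True
        by (intro exI[of _ "\<Prod>Q"] exI[of _ q0] conjI) auto
    next
      case False
      then have "coeff (unitary_cyclotomic ?N) q0 = coeff ?v q0"
        using coeff_eq_if_monom_dvd_diff[OF cong(2) l(2)[OF q0(1)]] Q(2) by simp
      then show ?thesis using v pos False
        by (intro exI[of _ "\<Prod>Q"] exI[of _ q0] conjI) auto
    qed
  qed
  show "\<exists>n\<ge>1. \<exists>j. coeff (unitary_cyclotomic (m * n)) j = mu_unitary m * (1 - int s)"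
    \<comment> \<open>\<open>2 * s + 1\<close> and, below, \<open>2 * s\<close> are cluster sizes of
      either parity that contain an \<open>s\<close>-th element.\<close>
    using main[of "2 * s + 1"] by simp
  have "\<exists>n\<ge>1. \<exists>j. - coeff (inverse_unitary_cyclotomic (m * n)) j = mu_unitary m * (1 - int s)"
    using main[of "2 * s"] by simp
  then show "\<exists>n\<ge>1. \<exists>j. coeff (inverse_unitary_cyclotomic (m * n)) j = mu_unitary m * (int s - 1)"
    by (metis minus_diff_eq minus_mult_minus minus_equation_iff mult_minus_right)
qed

text \<open>A prime above \<open>n\<close> is coprime to \<open>n\<close>, so multiplying by it
  flips the sign.\<close>

lemma ex_multiple_mu_unitary:
  assumes "m \<ge> 1" "e = 1 \<or> e = -1"
  shows "\<exists>k\<ge>1. m * k > 1 \<and> mu_unitary (m * k) = e"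
proof -
  have flip: "\<exists>k\<ge>1. n * k > 1 \<and> mu_unitary (n * k) = - mu_unitary n" if "n \<ge> 1" for n
  proof -
    obtain p where p: "prime p" "n < p" using bigger_prime by blast
    have "coprime p n" using p that by (intro prime_imp_coprime) (auto dest: dvd_imp_le)
    moreover have "primepow p" using p(1) by (simp add: primepow_prime)
    moreover have "n * p > 1" using p that by (metis less_le_trans le_less_trans mult_le_mono1 nat_mult_1 prime_gt_1_nat)
    ultimately show ?thesis using mu_unitary_mult_primepow[of n p] that p(2) by (intro exI[of _ p]) auto
  qed
  obtain k where k: "k \<ge> 1" "m * k > 1" "mu_unitary (m * k) = - mu_unitary m" using flip assms(1) by blast
  \<comment> \<open>A second flip restores the sign of \<open>m\<close> at an argument above 1,
    which \<open>m\<close> itself need not satisfy.\<close>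
  then obtain k' where k': "k' \<ge> 1" "m * k * k' > 1" "mu_unitary (m * k * k') = mu_unitary m"
    using flip[of "m * k"] by (auto simp del: One_nat_def)
  show ?thesis
  proof (cases "mu_unitary m = e")
    case True
    then show ?thesis using k k' by (intro exI[of _ "k * k'"]) (auto simp: mult.assoc)
  next
    case False
    then show ?thesis using k assms(2) mu_unitary_cases[of m] by (intro exI[of _ k]) auto
  qed
qed

theorem theorem3:
  fixes m :: nat
  assumes "m \<ge> 1"
  shows "{coeff (unitary_cyclotomic (m * n)) j | n j. n \<ge> 1}
           = {coeff (inverse_unitary_cyclotomic (m * n)) j | n j. n \<ge> 1}
       \<and> {coeff (inverse_unitary_cyclotomic (m * n)) j | n j. n \<ge> 1} = (UNIV :: int set)"
proof -
  have "(\<exists>n\<ge>1. \<exists>j. coeff (unitary_cyclotomic (m * n)) j = z) \<and>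
        (\<exists>n\<ge>1. \<exists>j. coeff (inverse_unitary_cyclotomic (m * n)) j = z)" for z :: int
  proof
    \<comment> \<open>With s - 1 = |z| the attained values are \<open>mu_unitary\<close> times 1 - s
      for the polynomial and times s - 1 for the inverse, so the two require opposite signs:
      \<open>- e\<close> and \<open>e\<close>.\<close>
    define e :: int where "e = (if z \<ge> 0 then 1 else - 1)"
    define s where "s = nat \<bar>z\<bar> + 1"
    have s: "s \<ge> 1" "z = e * (int s - 1)" "z = (- e) * (1 - int s)" by (auto simp: s_def e_def)
    have "- e = 1 \<or> - e = -1" "e = 1 \<or> e = -1" by (auto simp: e_def)
    then obtain k k' where k: "k \<ge> 1" "m * k > 1" "mu_unitary (m * k) = - e"
      and k': "k' \<ge> 1" "m * k' > 1" "mu_unitary (m * k') = e"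
      using ex_multiple_mu_unitary[OF assms] by metis
    obtain n j where "n \<ge> 1" "coeff (unitary_cyclotomic (m * k * n)) j = z"
      using coeff_unitary_cyclotomic_attains(1)[OF k(2) s(1)] k(3) s(3) by metis
    then show "\<exists>n\<ge>1. \<exists>j. coeff (unitary_cyclotomic (m * n)) j = z"
      using k(1) by (intro exI[of _ "k * n"]) (auto simp: mult.assoc)
    obtain n j where "n \<ge> 1" "coeff (inverse_unitary_cyclotomic (m * k' * n)) j = z"
      using coeff_unitary_cyclotomic_attains(2)[OF k'(2) s(1)] k'(3) s(2) by metis
    then show "\<exists>n\<ge>1. \<exists>j. coeff (inverse_unitary_cyclotomic (m * n)) j = z"
      using k'(1) by (intro exI[of _ "k' * n"]) (auto simp: mult.assoc)
  qed
  note ex = this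
  have "z \<in> {coeff (unitary_cyclotomic (m * n)) j | n j. n \<ge> 1}"
    "z \<in> {coeff (inverse_unitary_cyclotomic (m * n)) j | n j. n \<ge> 1}" for z :: int
    using ex[of z] by (auto simp del: One_nat_def) metis
  then show ?thesis by blast
qed

end
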